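(* Let $\varepsilon>0$. Suppose that the first and the second player choose the $\varepsilon$-good strategies $s_1^{\varepsilon}$, $s_2^{\varepsilon}$ and that the third player plays an arbitrary strategy $s_3:S\to\{I,NI\}$. Then for every $x_1\in S$ the trajectory $\bar{x}_T=\bar{x}_T((s_1^{\varepsilon},s_2^{\varepsilon},s_3),x_1)$, with coordinates $\bar{x}_T=(\bar{x}_T^1,\bar{x}_T^2,\bar{x}_T^3)$, satisfies $$\limsup_{T\to\infty}\bar{x}^3_{T}\leq p_3+\frac{2}{3}\varepsilon.$$
   Context: Stage game. There are three players $1,2,3$, each with the two actions $I$ (invest) and $NI$ (not invest). The game is symmetric: if exactly $n$ players invest, each investing player receives $p_n$ ($n=1,2,3$) and each non-investing player receives $r_n$ ($n=0,1,2$). Let $G:\{I,NI\}^3\to\mathbb{R}^3$ be the resulting vector payoff function (coordinate $i$ of $G(a)$ is the payoff of player $i$ under action profile $a$). Standing assumptions on the real numbers $r_0,r_1,r_2,p_1,p_2,p_3$: $0<r_0<r_1<r_2$; $0<p_1<p_2<p_3$; $p_1<r_0$; $3r_0<p_1+2r_1<2p_2+r_2<3p_3$; $p_1+r_1<2p_3$; $p_2<r_2$. Let $S\subset\mathbb{R}^3$ be the convex hull of the eight payoff vectors $G(a)$, $a\in\{I,NI\}^3$. Repeated game. A strategy of player $i$ is an arbitrary function $s_i:S\to\{I,NI\}$; a strategy profile is $s=(s_1,s_2,s_3):S\to\{I,NI\}^3$. Put $\varphi=G\circ s:S\to S$. For $x_1\in S$ the trajectory $\bar{x}_n=\bar{x}_n(s,x_1)$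 is defined by $\bar{x}_1=x_1$ and $\bar{x}_{n+1}=\frac{n\bar{x}_n+\varphi(\bar{x}_n)}{n+1}$ for $n\ge 1$. $\varepsilon$-good strategy. For $\varepsilon>0$ and $\{i,j,k\}=\{1,2,3\}$ let $\Omega_i^{\varepsilon}=\{x\in S: x_i>x_j-\varepsilon \text{ and } x_i>x_k-\varepsilon\}$, $W_i=\{x\in S: x_i<r_0 \text{ or } x_j+x_k>2p_3\}$, $V_i=\Omega_i^{\varepsilon}\setminus W_i$. The $\varepsilon$-good strategy of player $i$ is $s_i^{\varepsilon}(x)=I$ if $x\in V_i$ and $s_i^{\varepsilon}(x)=NI$ if $x\in S\setminus V_i$. *)

theory Defs
  imports "HOL-Analysis.Analysis"
begin

text \<open>
  The players are the elements of the type \<open>3\<close>, that is \<open>1\<close>, \<open>2\<close> and \<open>3\<close>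
  (where \<open>3 = 0\<close>). Of the payoff parameters \<open>p, r :: nat \<Rightarrow> real\<close> only
  \<open>p 1, p 2, p 3\<close> and \<open>r 0, r 1, r 2\<close> are ever used.
\<close>

datatype action = Invest | NotInvest

definition num_investors :: "(3 \<Rightarrow> action) \<Rightarrow> nat" where
  "num_investors a = card {j. a j = Invest}"

definition payoff :: "(nat \<Rightarrow> real) \<Rightarrow> (nat \<Rightarrow> real) \<Rightarrow> (3 \<Rightarrow> action) \<Rightarrow> real ^ 3" where
  "payoff p r a = (\<chi> i. if a i = Invest then p (num_investors a) else r (num_investors a))"

definition payoff_set :: "(nat \<Rightarrow> real) \<Rightarrow> (nat \<Rightarrow> real) \<Rightarrow> (real ^ 3) set" where
  "payoff_set p r = convex hull (range (payoff p r))"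

text \<open>
  A strategy is a map from the payoff set to actions. It is represented by a total function
  on \<open>real ^ 3\<close>; a trajectory that starts in the payoff set stays there, so the values
  elsewhere play no role.
\<close>

type_synonym strategy = "real ^ 3 \<Rightarrow> action"

definition stage_map ::
    "(nat \<Rightarrow> real) \<Rightarrow> (nat \<Rightarrow> real) \<Rightarrow> (3 \<Rightarrow> strategy) \<Rightarrow> real ^ 3 \<Rightarrow> real ^ 3" where
  "stage_map p r s x = payoff p r (\<lambda>i. s i x)"

text \<open>Trajectories are indexed from \<open>1\<close>; the value at index \<open>0\<close> is a dummy.\<close>

fun trajectory ::
    "(nat \<Rightarrow> real) \<Rightarrow> (nat \<Rightarrow> real) \<Rightarrow> (3 \<Rightarrow> strategy) \<Rightarrow> real ^ 3 \<Rightarrow> nat \<Rightarrow> real ^ 3" where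
  "trajectory p r s x\<^sub>1 0 = x\<^sub>1"
| "trajectory p r s x\<^sub>1 (Suc 0) = x\<^sub>1"
| "trajectory p r s x\<^sub>1 (Suc (Suc m)) =
     (let n = Suc m; y = trajectory p r s x\<^sub>1 n
      in (real n *\<^sub>R y + stage_map p r s y) /\<^sub>R (real n + 1))"

definition Omega_set ::
    "(nat \<Rightarrow> real) \<Rightarrow> (nat \<Rightarrow> real) \<Rightarrow> real \<Rightarrow> 3 \<Rightarrow> (real ^ 3) set" where
  "Omega_set p r \<epsilon> i = {x \<in> payoff_set p r. \<forall>j. j \<noteq> i \<longrightarrow> x $ i > x $ j - \<epsilon>}"

text \<open>The sum over \<open>- {i}\<close> is \<open>x\<^sub>j + x\<^sub>k\<close> for the two players \<open>j, k\<close> other than \<open>i\<close>.\<close>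

definition W_set :: "(nat \<Rightarrow> real) \<Rightarrow> (nat \<Rightarrow> real) \<Rightarrow> 3 \<Rightarrow> (real ^ 3) set" where
  "W_set p r i = {x \<in> payoff_set p r. x $ i < r 0 \<or> (\<Sum>j\<in>- {i}. x $ j) > 2 * p 3}"

definition V_set ::
    "(nat \<Rightarrow> real) \<Rightarrow> (nat \<Rightarrow> real) \<Rightarrow> real \<Rightarrow> 3 \<Rightarrow> (real ^ 3) set" where
  "V_set p r \<epsilon> i = Omega_set p r \<epsilon> i - W_set p r i"

definition good_strategy ::
    "(nat \<Rightarrow> real) \<Rightarrow> (nat \<Rightarrow> real) \<Rightarrow> real \<Rightarrow> 3 \<Rightarrow> strategy" where
  "good_strategy p r \<epsilon> i x = (if x \<in> V_set p r \<epsilon> i then Invest else NotInvest)"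

end

theory Submission
  imports Defs
begin

text \<open>
  If player \<open>i \<in> {1, 2}\<close> trails player \<open>3\<close> by at least \<open>\<epsilon>\<close>, then \<open>i\<close> does not invest, and a
  non-investor earns at least as much as player \<open>3\<close>. Hence the gaps \<open>x\<^sub>3 - x\<^sub>1\<close> and \<open>x\<^sub>3 - x\<^sub>2\<close> stay below
  \<open>\<epsilon>\<close> up to an error \<open>O(1/n)\<close>. The total stage payoff never exceeds \<open>3 p\<^sub>3\<close>, so the same holds for
  \<open>x\<^sub>1 + x\<^sub>2 + x\<^sub>3\<close>, up to the same error. Adding these three bounds gives
  \<open>3 x\<^sub>3 \<le> 3 p\<^sub>3 + 2 \<epsilon> + O(1/n)\<close>.
\<close>

lemma num_investors_eq:
  "num_investors a =
     of_bool (a 1 = Invest) + of_bool (a 2 = Invest) + of_bool (a 3 = Invest)"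
proof -
  have "num_investors a = (\<Sum>j\<in>UNIV. of_bool (a j = Invest))"
    by (simp add: num_investors_def of_bool_def flip: sum.inter_filter)
  then show ?thesis by (simp only: sum_3)
qed

text \<open>Players who act alike earn the same. If \<open>k\<close> invests and \<open>i\<close>
  does not, there are one or two investors, so the comparison is \<open>p n\<close> against
  \<open>r n\<close> for \<open>n = 1\<close> or \<open>n = 2\<close>.\<close>

lemma payoff_le_non_investor:
  assumes "a i = NotInvest" "i \<noteq> k" "p 1 \<le> r 1" "p 2 \<le> r 2"
  shows "payoff p r a $ k \<le> payoff p r a $ i"
proof (cases "a k")
  case NotInvest
  then show ?thesis using assms by (simp add: payoff_def)
next
  case Invest
  then have "num_investors a \<noteq> 0"
    by (auto simp: num_investors_def)
  moreover have "i \<notin> {j. a j = Invest}"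
    using assms(1) by simp
  then have "num_investors a < CARD(3)"
    unfolding num_investors_def by (intro psubset_card_mono) (simp, blast)
  ultimately have "num_investors a = 1 \<or> num_investors a = 2"
    by (simp; linarith)
  then show ?thesis using assms Invest by (auto simp: payoff_def)
qed

lemma sum_payoff_le:
  assumes "3 * r 0 \<le> 3 * p 3" "p 1 + 2 * r 1 \<le> 3 * p 3" "2 * p 2 + r 2 \<le> 3 * p 3"
  shows "(\<Sum>i\<in>UNIV. payoff p r a $ i) \<le> 3 * p 3"
  using assms
  by (cases "a 1"; cases "a 2"; cases "a 3")
     (simp_all add: sum_3 payoff_def num_investors_eq numeral_2_eq_2 numeral_3_eq_3)

lemma good_strategy_trailing:
  assumes "x $ i \<le> x $ j - \<epsilon>" "j \<noteq> i"
  shows "good_strategy p r \<epsilon> i x = NotInvest"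
  using assms by (force simp: good_strategy_def V_set_def Omega_set_def)

text \<open>Clearing the denominator turns the averaging rule into a running sum, which linear
  functionals preserve. It starts at index 1, since the initial point counts as the first
  summand.\<close>

lemma trajectory_Suc_scaled:
  assumes "n \<ge> 1"
  shows "real (Suc n) *\<^sub>R trajectory p r s x (Suc n) =
    real n *\<^sub>R trajectory p r s x n + stage_map p r s (trajectory p r s x n)"
  using assms by (cases n) (simp_all add: Let_def add.commute)

text \<open>The excess \<open>n * (d n - b)\<close> changes by \<open>u n - b\<close> in each step.
  It cannot grow while \<open>d n \<ge> b\<close>; when \<open>d n < b\<close> it is at most 0, and
  one step raises it by at most \<open>M - b\<close>.\<close>

lemma running_average_bounded_above:
  fixes d u :: "nat \<Rightarrow> real"
  assumes step: "\<And>n. n \<ge> 1 \<Longrightarrow> real (Suc n) * d (Suc n) = real n * d n + u n"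
    and bound: "\<And>n. u n \<le> M"
    and drift: "\<And>n. d n \<ge> b \<Longrightarrow> u n \<le> b"
  obtains C where "\<And>n. n \<ge> 1 \<Longrightarrow> real n * d n \<le> real n * b + C"
proof
  \<comment> \<open>The largest excess reachable in one step from below \<open>b\<close>, and the
    initial excess.\<close>
  let ?C = "max (M - b) (d 1 - b)"
  show "real n * d n \<le> real n * b + ?C" if "n \<ge> 1" for n
    using that
  proof (induction n rule: dec_induct)
    case base
    show ?case by simp
  next
    case (step n)
    have *: "real (Suc n) * b = real n * b + b" by (simp add: algebra_simps)
    show ?case
    proof (cases "d n \<ge> b")
      case True
      then show ?thesis using drift[of n] step assms(1)[of n] * by linarith
    next
      case False
      then have "real n * d n \<le> real n * b" by (intro mult_left_mono) auto
      then show ?thesis using bound[of n] step assms(1)[of n] * by linarith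
    qed
  qed
qed

lemma gap_to_good_player_bounded:
  assumes "s i = good_strategy p r \<epsilon> i" "i \<noteq> k" "\<epsilon> \<ge> 0" "p 1 \<le> r 1" "p 2 \<le> r 2"
  obtains C where "\<And>n. n \<ge> 1 \<Longrightarrow>
    real n * (trajectory p r s x n $ k - trajectory p r s x n $ i) \<le> real n * \<epsilon> + C"
proof -
  let ?t = "trajectory p r s x"
  let ?u = "\<lambda>n. stage_map p r s (?t n) $ k - stage_map p r s (?t n) $ i"
  \<comment> \<open>There are finitely many action profiles, so the maximum of \<open>?P\<close>
    serves as the uniform bound \<open>M\<close> on the increments.\<close>
  let ?P = "range (\<lambda>a. payoff p r a $ k - payoff p r a $ i)"
  have step: "real (Suc n) * (?t (Suc n) $ k - ?t (Suc n) $ i) =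
      real n * (?t n $ k - ?t n $ i) + ?u n" if "n \<ge> 1" for n
  proof -
    have "real (Suc n) * ?t (Suc n) $ j = real n * ?t n $ j + stage_map p r s (?t n) $ j" for j
      using arg_cong[OF trajectory_Suc_scaled[OF that], of "\<lambda>v. v $ j"]
      by (simp only: vector_add_component vector_scaleR_component real_scaleR_def)
    then show ?thesis by (simp only: right_diff_distrib)
  qed
  have fin: "finite ?P"
  proof -
    have "UNIV = {Invest, NotInvest}" using action.exhaust by blast
    then have "finite (UNIV :: action set)" by (metis finite.simps)
    then have "finite (UNIV :: (3 \<Rightarrow> action) set)" by (simp add: finite_UNIV_fun)
    then show ?thesis by simp
  qed
  have bound: "?u n \<le> Max ?P" for n
    using fin by (intro Max_ge) (auto simp: stage_map_def)
  \<comment> \<open>A gap of at least \<epsilon> makes \<open>i\<close> refrain from investing,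
    whatever the others do, so the stage gap is even nonpositive.\<close>
  have drift: "?u n \<le> \<epsilon>" if "?t n $ k - ?t n $ i \<ge> \<epsilon>" for n
  proof -
    have "s i (?t n) = NotInvest"
      using that assms(1,2) by (simp add: good_strategy_trailing[of _ _ k])
    then have "?u n \<le> 0"
      using payoff_le_non_investor[of "\<lambda>j. s j (?t n)" i k p r] assms
      by (simp add: stage_map_def)
    then show ?thesis using assms(3) by simp
  qed
  show thesis
    using running_average_bounded_above[of "\<lambda>n. ?t n $ k - ?t n $ i" ?u, OF step bound drift] that
    by blast
qed

lemma sum_trajectory_bounded:
  assumes "3 * r 0 \<le> 3 * p 3" "p 1 + 2 * r 1 \<le> 3 * p 3" "2 * p 2 + r 2 \<le> 3 * p 3"
  obtains C where "\<And>n. n \<ge> 1 \<Longrightarrow>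
    real n * (\<Sum>i\<in>UNIV. trajectory p r s x n $ i) \<le> real n * (3 * p 3) + C"
proof -
  let ?t = "trajectory p r s x"
  let ?u = "\<lambda>n. \<Sum>i\<in>UNIV. stage_map p r s (?t n) $ i"
  have step: "real (Suc n) * (\<Sum>i\<in>UNIV. ?t (Suc n) $ i) =
      real n * (\<Sum>i\<in>UNIV. ?t n $ i) + ?u n" if "n \<ge> 1" for n
    using arg_cong[OF trajectory_Suc_scaled[OF that], of "\<lambda>v. \<Sum>i\<in>UNIV. v $ i"]
    by (simp only: vector_add_component vector_scaleR_component real_scaleR_def
        sum.distrib sum_distrib_left)
  have bound: "?u n \<le> 3 * p 3" for n
    using sum_payoff_le[of r p, OF assms] by (simp add: stage_map_def)
  \<comment> \<open>The increment bound holds unconditionally, so it also serves as the drift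
    condition, with \<open>M = b = 3 * p 3\<close>.\<close>
  show thesis
    using running_average_bounded_above[of "\<lambda>n. \<Sum>i\<in>UNIV. ?t n $ i" ?u, OF step bound bound] that
    by blast
qed

theorem theorem3p2:
  fixes p r :: "nat \<Rightarrow> real" and \<epsilon> :: real
    and s :: "3 \<Rightarrow> strategy" and x\<^sub>1 :: "real ^ 3"
  assumes "0 < r 0" "r 0 < r 1" "r 1 < r 2"
    and "0 < p 1" "p 1 < p 2" "p 2 < p 3"
    and "p 1 < r 0"
    and "3 * r 0 < p 1 + 2 * r 1" "p 1 + 2 * r 1 < 2 * p 2 + r 2" "2 * p 2 + r 2 < 3 * p 3"
    and "p 1 + r 1 < 2 * p 3"
    and "p 2 < r 2"
    and "\<epsilon> > 0"
    and "s 1 = good_strategy p r \<epsilon> 1"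
    and "s 2 = good_strategy p r \<epsilon> 2"
    and "x\<^sub>1 \<in> payoff_set p r"
  shows "limsup (\<lambda>T. ereal (trajectory p r s x\<^sub>1 T $ 3)) \<le> ereal (p 3 + 2 / 3 * \<epsilon>)"
proof -
  let ?t = "trajectory p r s x\<^sub>1"
  have pr: "p 1 \<le> r 1" "p 2 \<le> r 2" "3 * r 0 \<le> 3 * p 3"
      "p 1 + 2 * r 1 \<le> 3 * p 3" "2 * p 2 + r 2 \<le> 3 * p 3"
    using assms by linarith+
  obtain C1 where C1: "\<And>n. n \<ge> 1 \<Longrightarrow> real n * (?t n $ 3 - ?t n $ 1) \<le> real n * \<epsilon> + C1"
    using gap_to_good_player_bounded[of s 1 p r \<epsilon> 3 x\<^sub>1] assms(13,14) pr by auto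
  obtain C2 where C2: "\<And>n. n \<ge> 1 \<Longrightarrow> real n * (?t n $ 3 - ?t n $ 2) \<le> real n * \<epsilon> + C2"
    using gap_to_good_player_bounded[of s 2 p r \<epsilon> 3 x\<^sub>1] assms(13,15) pr by auto
  obtain C3 where C3: "\<And>n. n \<ge> 1 \<Longrightarrow>
      real n * (\<Sum>i\<in>UNIV. ?t n $ i) \<le> real n * (3 * p 3) + C3"
    using sum_trajectory_bounded[of r p s x\<^sub>1] pr by auto
  define C where "C = (C1 + C2 + C3) / 3"
  \<comment> \<open>With \<open>y = ?t n\<close>, \<open>3 * y $ 3\<close> is the sum of the two
    gaps \<open>y $ 3 - y $ 1\<close> and \<open>y $ 3 - y $ 2\<close> and the coordinate sum of
    \<open>y\<close>. Adding the three bounds and dividing by \<open>3 * n\<close> gives the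
    claim.\<close>
  have upper: "?t n $ 3 \<le> p 3 + 2 / 3 * \<epsilon> + C / real n" if "n \<ge> 1" for n
    using C1[OF that] C2[OF that] C3[OF that] that
    by (simp add: sum_3 C_def field_simps)
  have "(\<lambda>n. p 3 + 2 / 3 * \<epsilon> + C / real n) \<longlonglongrightarrow> p 3 + 2 / 3 * \<epsilon> + 0"
    by (intro tendsto_intros lim_const_over_n)
  then have "limsup (\<lambda>n. ereal (p 3 + 2 / 3 * \<epsilon> + C / real n)) = ereal (p 3 + 2 / 3 * \<epsilon>)"
    by (intro lim_imp_Limsup) simp_all
  moreover have "limsup (\<lambda>n. ereal (?t n $ 3)) \<le>
      limsup (\<lambda>n. ereal (p 3 + 2 / 3 * \<epsilon> + C / real n))"
    using upper by (intro Limsup_mono eventually_sequentiallyI[of 1]) simp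
  ultimately show ?thesis by simp
qed

end
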